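(* Let $\nu$ be a multiplicative arithmetic function whose support has positive asymptotic density. Then the product $\prod_{p\notin\mathrm{supp}(\nu)}(1+1/p)^{-1}$ (over primes $p$) converges to a positive real number, and with $$C_\nu := \frac{6}{\pi^2}\prod_{p\notin\mathrm{supp}(\nu)}\left(1+\frac1p\right)^{-1}>0,$$ every pair $(f,g)$ of multiplicative arithmetic functions with $g=f*\nu$ satisfies $$\mathbf{d}(\mathrm{supp}(g)) \geq \frac{C_\nu}{\sum_{n\in\mathrm{supp}(f)}1/n},$$ where by convention $C_\nu/\infty := 0$ (in particular $\mathbf{d}(\mathrm{supp}(g))$ exists).
   Context: An arithmetic function is a function $\mathbb{N}\to\mathbb{C}$ ($\mathbb{N}$ the positive integers); it is multiplicative if $f(1)=1$ and $f(mn)=f(m)f(n)$ whenever $\gcd(m,n)=1$. The Dirichlet convolution is $(f*g)(n)=\sum_{d\mid n} f(d)\,g(n/d)$. $\mathrm{supp}(h)$ is the set of $n\in\mathbb{N}$ with $h(n)\neq0$. $\mathbf{d}(\mathcal{A})=\lim_{x\to\infty}\#(\mathcal{A}\cap[1,x])/x$ denotes asymptotic density. The letter $p$ denotes primes. *)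

theory Defs
  imports "HOL-Analysis.Analysis" "HOL-Computational_Algebra.Primes"
begin

text \<open>
  Arithmetic functions are rendered as \<open>nat \<Rightarrow> complex\<close>; the value at \<open>0\<close> is never used.
\<close>

definition multiplicative_fun :: "(nat \<Rightarrow> complex) \<Rightarrow> bool" where
  "multiplicative_fun f \<longleftrightarrow>
     f 1 = 1 \<and> (\<forall>m n. m > 0 \<longrightarrow> n > 0 \<longrightarrow> coprime m n \<longrightarrow> f (m * n) = f m * f n)"

definition dirichlet_conv :: "(nat \<Rightarrow> complex) \<Rightarrow> (nat \<Rightarrow> complex) \<Rightarrow> nat \<Rightarrow> complex" where
  "dirichlet_conv f g n = (\<Sum>d | d dvd n. f d * g (n div d))"

definition arith_supp :: "(nat \<Rightarrow> complex) \<Rightarrow> nat set" where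
  "arith_supp h = {n. n > 0 \<and> h n \<noteq> 0}"

definition has_density :: "nat set \<Rightarrow> real \<Rightarrow> bool" where
  "has_density A \<delta> \<longleftrightarrow>
     ((\<lambda>x::real. real (card {n \<in> A. 1 \<le> n \<and> real n \<le> x}) / x) \<longlongrightarrow> \<delta>) at_top"

text \<open>
  The product over primes outside the support is indexed by all of \<open>nat\<close>, with factor \<open>1\<close> at
  the other indices.  All factors lie in \<open>(0, 1]\<close>, so the order of multiplication is immaterial.
\<close>

definition nonsupp_factor :: "(nat \<Rightarrow> complex) \<Rightarrow> nat \<Rightarrow> real" where
  "nonsupp_factor \<nu> p =
     (if prime p \<and> p \<notin> arith_supp \<nu> then inverse (1 + 1 / real p) else 1)"

definition C_const :: "(nat \<Rightarrow> complex) \<Rightarrow> real" where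
  "C_const \<nu> = 6 / pi\<^sup>2 * (\<Prod>p. nonsupp_factor \<nu> p)"

end

theory Submission
  imports Defs
begin

text \<open>
  The support \<open>A\<close> of a multiplicative function is determined by the prime powers it contains.
  Imposing the conditions at the primes up to \<open>y\<close> only gives a superset of \<open>A\<close> whose density is the
  product of the local densities \<open>(1 - 1/p) \<Sum> 1/p\<^sup>k\<close>, the sum over \<open>k\<close> with \<open>p\<^sup>k \<in> A\<close>, and
  letting \<open>y\<close> grow shows that \<open>A\<close> has density the full product. A positive density therefore forces
  the reciprocals of the primes outside \<open>A\<close> to have a finite sum.

  For \<open>g = f * \<nu>\<close> let \<open>F\<close> and \<open>G\<close> be the local series of the supports of \<open>f\<close> and \<open>g\<close> at \<open>p\<close>.
  Both are at least \<open>1\<close>, and if \<open>\<nu> p \<noteq> 0\<close>, then \<open>f p\<close> and \<open>g p = f p + \<nu> p\<close> do not both vanish,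
  whence \<open>F G \<ge> 1 + 1/p\<close>. Multiplying over \<open>p\<close> and bounding the partial Euler products of \<open>\<zeta>(2)\<close>
  and of \<open>\<Sum> 1/n\<close> over the support of \<open>f\<close> by the full sums gives the inequality.
\<close>

section \<open>Counting functions and densities\<close>

definition count_upto :: "nat set \<Rightarrow> real \<Rightarrow> real" where
  "count_upto A x = real (card {n \<in> A. 1 \<le> n \<and> real n \<le> x})"

lemma has_density_count: "has_density A \<delta> \<longleftrightarrow> ((\<lambda>x. count_upto A x / x) \<longlongrightarrow> \<delta>) at_top"
  by (simp add: has_density_def count_upto_def)

lemma finite_upto: "finite {n \<in> A. 1 \<le> n \<and> real n \<le> x}"
  by (rule finite_subset[of _ "{..nat \<lfloor>x\<rfloor>}"]) (auto simp: le_nat_floor)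

lemma count_upto_nonneg: "count_upto A x \<ge> 0"
  by (simp add: count_upto_def)

lemma count_upto_mono: "A \<subseteq> B \<Longrightarrow> count_upto A x \<le> count_upto B x"
  unfolding count_upto_def of_nat_le_iff by (rule card_mono[OF finite_upto]) auto

lemma count_upto_Un_disjoint:
  assumes "A \<inter> B = {}"
  shows "count_upto (A \<union> B) x = count_upto A x + count_upto B x"
proof -
  have "{n \<in> A \<union> B. 1 \<le> n \<and> real n \<le> x} =
      {n \<in> A. 1 \<le> n \<and> real n \<le> x} \<union> {n \<in> B. 1 \<le> n \<and> real n \<le> x}" by auto
  moreover have "{n \<in> A. 1 \<le> n \<and> real n \<le> x} \<inter> {n \<in> B. 1 \<le> n \<and> real n \<le> x} = {}"
    using assms by auto
  ultimately show ?thesis unfolding count_upto_def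
    by (simp only: card_Un_disjoint[OF finite_upto finite_upto] of_nat_add)
qed

lemma count_upto_diff:
  assumes "B \<subseteq> A"
  shows "count_upto (A - B) x = count_upto A x - count_upto B x"
proof -
  have "(A - B) \<union> B = A" using assms by auto
  moreover have "(A - B) \<inter> B = {}" by auto
  ultimately show ?thesis using count_upto_Un_disjoint[of "A - B" B x] by simp
qed

lemma count_upto_Un_le: "count_upto (A \<union> B) x \<le> count_upto A x + count_upto B x"
proof -
  have "A \<union> B = A \<union> (B - A)" by auto
  then have "count_upto (A \<union> B) x = count_upto A x + count_upto (B - A) x"
    using count_upto_Un_disjoint[of A "B - A"] by simp
  then show ?thesis using count_upto_mono[of "B - A" B x] by auto
qed

lemma count_upto_UN_le:
  assumes "finite I"
  shows "count_upto (\<Union>i\<in>I. A i) x \<le> (\<Sum>i\<in>I. count_upto (A i) x)"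
  using assms
proof (induction I rule: finite_induct)
  case empty
  then show ?case by (simp add: count_upto_def)
next
  case (insert i I)
  then show ?case using count_upto_Un_le[of "A i" "\<Union>i\<in>I. A i" x] by simp
qed

lemma count_upto_le: "x \<ge> 0 \<Longrightarrow> count_upto A x \<le> x"
proof -
  assume x: "x \<ge> 0"
  have "card {n \<in> A. 1 \<le> n \<and> real n \<le> x} \<le> card {1..nat \<lfloor>x\<rfloor>}"
    by (rule card_mono) (auto simp: le_nat_floor)
  then have "count_upto A x \<le> real (nat \<lfloor>x\<rfloor>)" by (simp add: count_upto_def)
  also have "\<dots> \<le> x" using x by linarith
  finally show ?thesis .
qed

lemma count_upto_scale:
  assumes "c > 0"
  shows "count_upto ((*) c ` A) x = count_upto A (x / real c)"
proof -
  have "{n \<in> (*) c ` A. 1 \<le> n \<and> real n \<le> x} = (*) c ` {n \<in> A. 1 \<le> n \<and> real n \<le> x / real c}"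
    using assms by (auto simp: field_simps)
  then show ?thesis
    using assms by (simp add: count_upto_def card_image inj_on_def)
qed

lemma count_upto_multiples_le:
  assumes "c > 0" "x \<ge> 0"
  shows "count_upto {n. c dvd n} x \<le> x / real c"
proof -
  have "{n. c dvd n} = (*) c ` UNIV" by (auto elim: dvdE)
  then show ?thesis using assms by (simp add: count_upto_scale count_upto_le)
qed

section \<open>Scaling, finite additivity and approximation of densities\<close>

lemma has_density_scale:
  assumes "has_density A \<delta>" "c > 0"
  shows "has_density ((*) c ` A) (\<delta> / real c)"
proof -
  have "filterlim (\<lambda>x::real. x / real c) at_top at_top"
    using assms(2) filterlim_tendsto_pos_mult_at_top[OF tendsto_const[of "1 / real c"] _ filterlim_ident]
    by simp
  then have "((\<lambda>x. count_upto A (x / real c) / (x / real c)) \<longlongrightarrow> \<delta>) at_top"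
    using assms(1) unfolding has_density_count by (rule filterlim_compose[rotated])
  then have "((\<lambda>x. count_upto A (x / real c) / (x / real c) / real c) \<longlongrightarrow> \<delta> / real c) at_top"
    by (intro tendsto_divide tendsto_const) (use assms(2) in auto)
  then show ?thesis using assms(2) by (simp add: has_density_count count_upto_scale)
qed

lemma has_density_Un_disjoint:
  assumes "has_density A \<alpha>" "has_density B \<beta>" "A \<inter> B = {}"
  shows "has_density (A \<union> B) (\<alpha> + \<beta>)"
  using tendsto_add[OF assms(1,2)[unfolded has_density_count]]
  by (simp add: has_density_count count_upto_Un_disjoint[OF assms(3)] add_divide_distrib)

lemma has_density_diff:
  assumes "has_density A \<alpha>" "has_density B \<beta>" "B \<subseteq> A"
  shows "has_density (A - B) (\<alpha> - \<beta>)"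
  using tendsto_diff[OF assms(1,2)[unfolded has_density_count]]
  by (simp add: has_density_count count_upto_diff[OF assms(3)] diff_divide_distrib)

lemma has_density_empty: "has_density {} 0"
  by (simp add: has_density_count count_upto_def)

lemma has_density_UN_disjoint:
  assumes "finite I" "\<And>i. i \<in> I \<Longrightarrow> has_density (A i) (\<delta> i)" "disjoint_family_on A I"
  shows "has_density (\<Union>i\<in>I. A i) (\<Sum>i\<in>I. \<delta> i)"
  using assms
proof (induction I rule: finite_induct)
  case empty
  then show ?case by (simp add: has_density_empty)
next
  case (insert i I)
  have "has_density (\<Union>i\<in>I. A i) (\<Sum>i\<in>I. \<delta> i)"
    using insert by (auto simp: disjoint_family_on_def)
  moreover have "A i \<inter> (\<Union>i\<in>I. A i) = {}"
    using insert.prems(2) insert.hyps(2) by (fastforce simp: disjoint_family_on_def)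
  ultimately show ?case
    using has_density_Un_disjoint[of "A i" "\<delta> i" "\<Union>i\<in>I. A i"] insert by simp
qed

text \<open>Natural density is not countably additive, and this is the substitute. The error bound
  \<open>\<epsilon> k * x\<close> holds for every \<open>x > 0\<close> at once, so the limits in
  \<open>k\<close> and \<open>x\<close> may be exchanged by an \<open>e / 3\<close>
  argument.\<close>

lemma has_density_approx:
  assumes "\<And>k. has_density (S k) (\<delta> k)"
    and close: "\<And>k x. x > 0 \<Longrightarrow> \<bar>count_upto (S k) x - count_upto A x\<bar> \<le> \<epsilon> k * x"
    and "\<epsilon> \<longlonglongrightarrow> 0" "\<delta> \<longlonglongrightarrow> l"
  shows "has_density A l"
  unfolding has_density_count
proof (rule tendstoI)
  fix e :: real assume e: "e > 0"
  have "eventually (\<lambda>k. dist (\<epsilon> k) 0 < e / 3 \<and> dist (\<delta> k) l < e / 3) sequentially"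
    using e assms(3,4) by (intro eventually_conj tendstoD) auto
  then obtain k where k: "dist (\<epsilon> k) 0 < e / 3" "dist (\<delta> k) l < e / 3"
    by (auto simp: eventually_sequentially)
  have "eventually (\<lambda>x. dist (count_upto (S k) x / x) (\<delta> k) < e / 3) at_top"
    using e assms(1)[of k] unfolding has_density_count by (intro tendstoD) auto
  then show "eventually (\<lambda>x. dist (count_upto A x / x) l < e) at_top"
    using eventually_gt_at_top[of 0]
  proof eventually_elim
    case (elim x)
    have "\<bar>count_upto (S k) x / x - count_upto A x / x\<bar> = \<bar>count_upto (S k) x - count_upto A x\<bar> / x"
      using elim by (simp add: diff_divide_distrib[symmetric])
    also have "\<dots> \<le> \<epsilon> k" using close[of x k] elim by (simp add: field_simps)
    finally show ?case using elim k unfolding dist_real_def by linarith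
  qed
qed

lemma has_density_positive: "has_density {n. n > 0} 1"
proof -
  have "((\<lambda>x::real. 1 - inverse x) \<longlongrightarrow> 1 - 0) at_top"
    by (intro tendsto_diff tendsto_const tendsto_inverse_0_at_top filterlim_ident)
  moreover have "eventually (\<lambda>x. 1 - inverse x \<le> count_upto {n. n > 0} x / x) at_top"
    using eventually_gt_at_top[of 0]
  proof eventually_elim
    case (elim x)
    have "{n \<in> {n. n > 0}. 1 \<le> n \<and> real n \<le> x} = {1..nat \<lfloor>x\<rfloor>}"
      using elim by (auto simp: le_nat_floor le_nat_iff le_floor_iff)
    then have "count_upto {n. n > 0} x = real (nat \<lfloor>x\<rfloor>)" by (simp add: count_upto_def)
    also have "\<dots> \<ge> x - 1" using elim by linarith
    finally have "(x - 1) / x \<le> count_upto {n. n > 0} x / x" using elim by (simp add: divide_right_mono)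
    then show ?case using elim by (simp add: diff_divide_distrib inverse_eq_divide)
  qed
  moreover have "eventually (\<lambda>x. count_upto {n. n > 0} x / x \<le> 1) at_top"
    using eventually_gt_at_top[of 0]
    by eventually_elim (use count_upto_le in auto)
  ultimately show ?thesis
    unfolding has_density_count
    using tendsto_sandwich[of "\<lambda>x. 1 - inverse x" _ at_top "\<lambda>_. 1" 1] by simp
qed


section \<open>Densities of multiplicative sets\<close>

definition multiplicative_set :: "nat set \<Rightarrow> bool" where
  "multiplicative_set A \<longleftrightarrow> 0 \<notin> A \<and> 1 \<in> A \<and>
     (\<forall>m n. m > 0 \<longrightarrow> n > 0 \<longrightarrow> coprime m n \<longrightarrow> (m * n \<in> A \<longleftrightarrow> m \<in> A \<and> n \<in> A))"

text \<open>The complex numbers have no zero divisors, so a product of two values is nonzero exactly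
  when both values are. The density arguments below therefore concern sets only.\<close>

lemma multiplicative_set_arith_supp:
  "multiplicative_fun f \<Longrightarrow> multiplicative_set (arith_supp f)"
  by (auto simp: multiplicative_fun_def multiplicative_set_def arith_supp_def)

lemma multiplicity_mult_other_prime:
  fixes p q m :: nat
  assumes "prime p" "prime q" "p \<noteq> q"
  shows "multiplicity q (p ^ k * m) = multiplicity q m"
proof -
  have "\<not> q dvd p ^ k" using assms by (metis prime_dvd_power primes_dvd_imp_eq)
  then show ?thesis using assms by (intro multiplicity_prime_elem_times_other) auto
qed

text \<open>Strong induction: splitting off the full power of one prime divisor leaves a smaller
  coprime cofactor, whose multiplicities at the other primes are those of \<open>n\<close>.\<close>

lemma multiplicative_set_iff:
  assumes A: "multiplicative_set A" and "n > 0"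
  shows "n \<in> A \<longleftrightarrow> (\<forall>p. prime p \<longrightarrow> p ^ multiplicity p n \<in> A)"
  using assms(2)
proof (induction n rule: less_induct)
  case (less n)
  show ?case
  proof (cases "n = 1")
    case True
    then show ?thesis using A by (auto simp: multiplicative_set_def)
  next
    case False
    then obtain p where p: "prime p" "p dvd n" using prime_factor_nat by blast
    obtain m where m: "n = p ^ multiplicity p n * m" "\<not> p dvd m"
      using multiplicity_decompose'[of n p] p less.prems
      by (metis not_prime_unit neq0_conv)
    define k where "k = multiplicity p n"
    have nk: "n = p ^ k * m" using m(1) by (simp add: k_def)
    have "k > 0" using p less.prems by (simp add: k_def prime_multiplicity_gt_zero_iff)
    have "m > 0" using less.prems nk by (cases m) auto
    have "p ^ k > 1" using \<open>k > 0\<close> p(1) prime_gt_1_nat[of p] by (metis one_less_power)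
    then have "m < n" using nk \<open>m > 0\<close> by simp
    have "coprime (p ^ k) m" using m(2) p(1) by (simp add: prime_imp_coprime)
    moreover have "p ^ k > 0" using \<open>p ^ k > 1\<close> by linarith
    ultimately have "n \<in> A \<longleftrightarrow> p ^ k \<in> A \<and> m \<in> A"
      using A \<open>m > 0\<close> unfolding multiplicative_set_def nk by blast
    also have "m \<in> A \<longleftrightarrow> (\<forall>q. prime q \<longrightarrow> q ^ multiplicity q m \<in> A)"
      using less.IH \<open>m < n\<close> \<open>m > 0\<close> by blast
    also have "p ^ k \<in> A \<and> (\<forall>q. prime q \<longrightarrow> q ^ multiplicity q m \<in> A) \<longleftrightarrow>
        (\<forall>q. prime q \<longrightarrow> q ^ multiplicity q n \<in> A)"
    proof -
      have "q ^ multiplicity q m \<in> A \<longleftrightarrow> q ^ multiplicity q n \<in> A" if "prime q" "q \<noteq> p" for q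
        using multiplicity_mult_other_prime[of p q k m] that p(1) nk by simp
      \<comment> \<open>At \<open>p\<close> itself the cofactor has multiplicity \<open>0\<close>
        and only asks for \<open>1 \<in> A\<close>, so the condition for \<open>n\<close> differs
        from that for \<open>m\<close> at \<open>p\<close> alone.\<close>
      moreover have "p ^ multiplicity p m \<in> A"
        using A m(2) by (simp add: not_dvd_imp_multiplicity_0 multiplicative_set_def)
      ultimately show ?thesis using p(1) unfolding k_def by blast
    qed
    finally show ?thesis .
  qed
qed

section \<open>Euler factors and local densities at a single prime\<close>

definition local_series :: "nat set \<Rightarrow> nat \<Rightarrow> real" where
  "local_series A p = (\<Sum>k. if p ^ k \<in> A then 1 / real p ^ k else 0)"

text \<open>For prime \<open>p\<close> this is the density of the \<open>n\<close> with
  \<open>p ^ multiplicity p n \<in> A\<close>, because multiplicity exactly \<open>k\<close> has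
  density \<open>(1 - 1/p) / p^k\<close>. The series is the Euler factor at \<open>s = 1\<close> of
  the sum of \<open>1 / n^s\<close> over a multiplicative set \<open>A\<close>.\<close>

definition local_density :: "nat set \<Rightarrow> nat \<Rightarrow> real" where
  "local_density A p = (1 - 1 / real p) * local_series A p"

lemma geometric_inverse_sums:
  assumes "p \<ge> (2::nat)"
  shows "(\<lambda>k. 1 / real p ^ k) sums (1 / (1 - 1 / real p))"
  using geometric_sums[of "1 / real p"] assms by (simp add: power_one_over)

lemma summable_local_series:
  assumes "p \<ge> (2::nat)"
  shows "summable (\<lambda>k. if p ^ k \<in> A then 1 / real p ^ k else 0)"
  by (rule summable_comparison_test'[OF sums_summable[OF geometric_inverse_sums[OF assms]], of 0]) auto

lemma local_series_ge_sum:
  assumes "p \<ge> (2::nat)" "finite K" "\<And>k. k \<in> K \<Longrightarrow> p ^ k \<in> A"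
  shows "(\<Sum>k\<in>K. 1 / real p ^ k) \<le> local_series A p"
proof -
  have "(\<Sum>k\<in>K. 1 / real p ^ k) = (\<Sum>k\<in>K. if p ^ k \<in> A then 1 / real p ^ k else 0)"
    using assms by (intro sum.cong) auto
  also have "\<dots> \<le> local_series A p"
    unfolding local_series_def using assms by (intro sum_le_suminf summable_local_series) auto
  finally show ?thesis .
qed

lemma local_series_ge_1: "p \<ge> 2 \<Longrightarrow> 1 \<in> A \<Longrightarrow> local_series A p \<ge> 1"
  using local_series_ge_sum[of p "{0}" A] by simp

lemma local_series_ge_2:
  assumes "p \<ge> 2" "1 \<in> A" "p \<in> A"
  shows "local_series A p \<ge> 1 + 1 / real p"
proof -
  have "p ^ k \<in> A" if "k \<in> {0, 1}" for k using that assms by auto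
  from local_series_ge_sum[OF assms(1) _ this, of "{0, 1}"] show ?thesis by simp
qed

text \<open>Termwise comparison with the full geometric series, from which the term
  \<open>k = 1\<close> is struck out when \<open>p\<close> is missing from \<open>A\<close>.\<close>

lemma local_series_le:
  assumes "p \<ge> 2"
  shows "local_series A p \<le> 1 / (1 - 1 / real p) - (if p \<in> A then 0 else 1 / real p)"
proof -
  \<comment> \<open>The struck-out term is written as a series with at most one nonzero entry, so
    that two series can be compared term by term.\<close>
  have 1: "(\<lambda>k. if k = 1 then (if p \<in> A then 0 else 1 / real p) else 0) sums
      (if p \<in> A then 0 else 1 / real p)"
    by (rule sums_single)
  show ?thesis
    unfolding local_series_def
    by (rule sums_le[OF _ summable_sums[OF summable_local_series[OF assms]]
          sums_diff[OF geometric_inverse_sums[OF assms] 1]]) auto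
qed

lemma local_density_nonneg:
  assumes "p \<ge> 2"
  shows "local_density A p \<ge> 0"
  using local_series_ge_sum[of p "{}" A] assms by (simp add: local_density_def)

lemma local_density_le:
  assumes "p \<ge> 2"
  shows "local_density A p \<le> 1 - (1 - 1 / real p) * (if p \<in> A then 0 else 1 / real p)"
proof -
  have pos: "1 - 1 / real p > 0" using assms by simp
  have "local_density A p \<le>
      (1 - 1 / real p) * (1 / (1 - 1 / real p) - (if p \<in> A then 0 else 1 / real p))"
    unfolding local_density_def
    by (rule mult_left_mono[OF local_series_le[OF assms]]) (use pos in simp)
  also have "\<dots> = 1 - (1 - 1 / real p) * (if p \<in> A then 0 else 1 / real p)"
    using assms by (simp add: right_diff_distrib)
  finally show ?thesis .
qed

lemma local_density_le_1: "p \<ge> 2 \<Longrightarrow> local_density A p \<le> 1"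
  by (rule order_trans[OF local_density_le]) auto

text \<open>The exponential form later turns a lower bound for a product into an upper bound for a
  sum of reciprocals. The divisor \<open>2\<close> in the exponent comes from
  \<open>1 - 1/p \<ge> 1/2\<close>.\<close>

lemma local_density_le_exp:
  assumes "p \<ge> 2" "p \<notin> A"
  shows "local_density A p \<le> exp (- (1 / real p) / 2)"
proof -
  have "local_density A p \<le> 1 - (1 - 1 / real p) * (1 / real p)"
    using local_density_le[of p A] assms by simp
  also have "\<dots> \<le> 1 - (1 / 2) * (1 / real p)"
  proof -
    have "1 / 2 \<le> 1 - 1 / real p" using assms by (simp add: field_simps)
    then have "(1 / 2) * (1 / real p) \<le> (1 - 1 / real p) * (1 / real p)"
      by (rule mult_right_mono) simp
    then show ?thesis by linarith
  qed
  also have "\<dots> \<le> exp (- (1 / real p) / 2)"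
    using exp_ge_add_one_self[of "- (1 / real p) / 2"] by simp
  finally show ?thesis .
qed

section \<open>Sieving by finitely many primes\<close>

definition sieved :: "nat set \<Rightarrow> nat set \<Rightarrow> nat set" where
  "sieved A P = {n. n > 0 \<and> (\<forall>p\<in>P. p ^ multiplicity p n \<in> A)}"

text \<open>Conditions at the primes of \<open>P\<close> do not see the power of another prime, so
  powers of \<open>p\<close> can be inserted or removed freely when the condition at
  \<open>p\<close> is added.\<close>

lemma sieved_prime_power_mult:
  assumes "\<And>q. q \<in> P \<Longrightarrow> prime q" "prime p" "p \<notin> P"
  shows "p ^ k * m \<in> sieved A P \<longleftrightarrow> m \<in> sieved A P"
proof -
  have "multiplicity q (p ^ k * m) = multiplicity q m" if "q \<in> P" for q
    using assms that by (intro multiplicity_mult_other_prime) auto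
  then show ?thesis using assms(2) by (auto simp: sieved_def prime_gt_0_nat)
qed

text \<open>The new sieved set splits by the exact power of \<open>p\<close> into the layers
  \<open>p^k * T\<close> with \<open>p^k \<in> A\<close>, where \<open>T\<close> is the part of the
  old set prime to \<open>p\<close>. The layers have densities
  \<open>(1 - 1/p) * \<delta> / p^k\<close>, and these add up to the local density times
  \<delta>.\<close>

lemma has_density_sieved_insert:
  assumes S: "has_density (sieved A P) \<delta>"
    and P: "\<And>q. q \<in> P \<Longrightarrow> prime q" and p: "prime p" "p \<notin> P"
  shows "has_density (sieved A (insert p P)) (local_density A p * \<delta>)"
proof -
  have p2: "p \<ge> 2" using p(1) by (rule prime_ge_2_nat)
  \<comment> \<open>Multiplication by \<open>p\<close> maps the sieved set onto its multiples of
    \<open>p\<close>, of density \<open>\<delta> / p\<close>; removing them leaves density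
    \<open>\<delta> - \<delta> / p\<close>.\<close>
  define T where "T = sieved A P - (*) p ` sieved A P"
  have sub: "(*) p ` sieved A P \<subseteq> sieved A P"
    using sieved_prime_power_mult[of P p 1 _ A] P p by auto
  have dT: "has_density T (\<delta> - \<delta> / real p)"
    unfolding T_def by (rule has_density_diff[OF S has_density_scale[OF S] sub]) (use p2 in auto)
  have T: "m \<in> T \<longleftrightarrow> m \<in> sieved A P \<and> \<not> p dvd m" for m
  proof -
    have "m \<in> (*) p ` sieved A P \<longleftrightarrow> m \<in> sieved A P \<and> p dvd m"
      using sieved_prime_power_mult[of P p 1 _ A] P p by (auto elim!: dvdE)
    then show ?thesis by (auto simp: T_def)
  qed
  \<comment> \<open>The exponent of \<open>p\<close> can be read off from \<open>p ^ k * m\<close>.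
    This makes the layers disjoint and identifies the condition at \<open>p\<close> on each of
    them.\<close>
  have mult: "multiplicity p (p ^ k * m) = k" if "m \<in> T" for k m
  proof (rule multiplicity_eqI)
    show "\<not> p ^ Suc k dvd p ^ k * m" using that T p2 by (auto simp: mult.commute)
  qed simp
  have decomp: "n \<in> sieved A (insert p P) \<longleftrightarrow> (\<exists>k. p ^ k \<in> A \<and> (\<exists>m\<in>T. n = p ^ k * m))" for n
  proof
    assume n: "n \<in> sieved A (insert p P)"
    then have n0: "n \<noteq> 0" and nP: "n \<in> sieved A P" and nA: "p ^ multiplicity p n \<in> A"
      by (auto simp: sieved_def)
    obtain m where m: "n = p ^ multiplicity p n * m" "\<not> p dvd m"
      using multiplicity_decompose'[of n p] n0 p(1) by (metis not_prime_unit)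
    have "m \<in> sieved A P"
      using sieved_prime_power_mult[of P p "multiplicity p n" m A] P p nP m(1) by simp
    then have "m \<in> T" using T m(2) by simp
    then show "\<exists>k. p ^ k \<in> A \<and> (\<exists>m\<in>T. n = p ^ k * m)" using nA m(1) by blast
  next
    assume "\<exists>k. p ^ k \<in> A \<and> (\<exists>m\<in>T. n = p ^ k * m)"
    then obtain k m where k: "p ^ k \<in> A" "m \<in> T" "n = p ^ k * m" by blast
    then have "n \<in> sieved A P" using sieved_prime_power_mult[of P p k m A] P p T by simp
    then show "n \<in> sieved A (insert p P)" using k mult[of m k] by (auto simp: sieved_def)
  qed
  \<comment> \<open>There may be infinitely many layers, so they are cut off at
    \<open>k < K\<close>. What is lost consists of multiples of \<open>p ^ K\<close>, at most
    \<open>x / p ^ K\<close> of them up to \<open>x\<close>.\<close>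
  define I where "I K = {k. k < K \<and> p ^ k \<in> A}" for K :: nat
  define U where "U K = (\<Union>k\<in>I K. (*) (p ^ k) ` T)" for K
  define d where "d K = (\<Sum>k\<in>I K. (\<delta> - \<delta> / real p) / real (p ^ k))" for K
  have "has_density (U K) (d K)" for K
    unfolding U_def d_def
  proof (rule has_density_UN_disjoint)
    show "finite (I K)" by (simp add: I_def)
    show "has_density ((*) (p ^ k) ` T) ((\<delta> - \<delta> / real p) / real (p ^ k))" for k
      by (rule has_density_scale[OF dT]) (use p2 in simp)
    show "disjoint_family_on (\<lambda>k. (*) (p ^ k) ` T) (I K)"
      unfolding disjoint_family_on_def using mult by (auto simp: disjoint_iff) (metis mult)
  qed
  moreover have "\<bar>count_upto (U K) x - count_upto (sieved A (insert p P)) x\<bar> \<le> (1 / real p) ^ K * x"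
    if "x > 0" for K x
  proof -
    have sub: "U K \<subseteq> sieved A (insert p P)" using decomp by (auto simp: U_def I_def)
    have "sieved A (insert p P) - U K \<subseteq> {n. p ^ K dvd n}"
    proof
      fix n assume n: "n \<in> sieved A (insert p P) - U K"
      then obtain k m where k: "p ^ k \<in> A" "m \<in> T" "n = p ^ k * m" using decomp by blast
      then have "k \<ge> K" using n by (auto simp: U_def I_def not_less[symmetric])
      then show "n \<in> {n. p ^ K dvd n}" using k by (simp add: le_imp_power_dvd)
    qed
    then have "count_upto (sieved A (insert p P) - U K) x \<le> count_upto {n. p ^ K dvd n} x"
      by (rule count_upto_mono)
    also have "\<dots> \<le> x / real (p ^ K)"
      by (rule count_upto_multiples_le) (use p2 that in auto)
    finally show ?thesis
      using count_upto_mono[OF sub, of x] by (simp add: count_upto_diff[OF sub] power_one_over)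
  qed
  moreover have "(\<lambda>K. (1 / real p) ^ K) \<longlonglongrightarrow> 0"
    using p2 by (intro LIMSEQ_power_zero) simp
  moreover have "d \<longlonglongrightarrow> local_density A p * \<delta>"
  proof -
    have "d = (\<lambda>K. (\<delta> - \<delta> / real p) * (\<Sum>k<K. if p ^ k \<in> A then 1 / real p ^ k else 0))"
    proof
      fix K
      have "d K = (\<Sum>k<K. if p ^ k \<in> A then (\<delta> - \<delta> / real p) / real (p ^ k) else 0)"
        unfolding d_def I_def by (simp add: sum.inter_filter[symmetric] lessThan_def)
      also have "\<dots> = (\<delta> - \<delta> / real p) * (\<Sum>k<K. if p ^ k \<in> A then 1 / real p ^ k else 0)"
        unfolding sum_distrib_left by (intro sum.cong) auto
      finally show "d K = (\<delta> - \<delta> / real p) * (\<Sum>k<K. if p ^ k \<in> A then 1 / real p ^ k else 0)" .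
    qed
    moreover have "(\<lambda>K. (\<delta> - \<delta> / real p) * (\<Sum>k<K. if p ^ k \<in> A then 1 / real p ^ k else 0))
        \<longlonglongrightarrow> (\<delta> - \<delta> / real p) * local_series A p"
      unfolding local_series_def
      by (intro tendsto_mult tendsto_const summable_LIMSEQ summable_local_series p2)
    moreover have "(\<delta> - \<delta> / real p) * local_series A p = local_density A p * \<delta>"
      by (simp add: local_density_def algebra_simps)
    ultimately show ?thesis by simp
  qed
  ultimately show ?thesis by (rule has_density_approx)
qed

lemma has_density_sieved:
  assumes "finite P" "\<And>p. p \<in> P \<Longrightarrow> prime p"
  shows "has_density (sieved A P) (\<Prod>p\<in>P. local_density A p)"
  using assms
proof (induction P rule: finite_induct)
  case empty
  then show ?case using has_density_positive by (simp add: sieved_def)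
next
  case (insert p P)
  then show ?case using has_density_sieved_insert[of A P "\<Prod>p\<in>P. local_density A p" p] by simp
qed

section \<open>Products of local densities over the primes up to a bound\<close>

definition primes_upto :: "nat \<Rightarrow> nat set" where
  "primes_upto y = {p. prime p \<and> p \<le> y}"

lemma finite_primes_upto [simp]: "finite (primes_upto y)"
  by (simp add: primes_upto_def)

lemma primes_upto_prime: "p \<in> primes_upto y \<Longrightarrow> prime p"
  by (simp add: primes_upto_def)

lemma primes_upto_ge_2: "p \<in> primes_upto y \<Longrightarrow> p \<ge> 2"
  by (simp add: primes_upto_def prime_ge_2_nat)

text \<open>Extended by \<open>0\<close> to all of \<open>nat\<close>, so that convergence over the
  missing primes becomes summability of an ordinary series.\<close>

definition missing_prime_weight :: "nat set \<Rightarrow> nat \<Rightarrow> real" where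
  "missing_prime_weight A n = (if prime n \<and> n \<notin> A then 1 / real n else 0)"

lemma missing_prime_weight_nonneg: "missing_prime_weight A n \<ge> 0"
  by (simp add: missing_prime_weight_def)

lemma prod_local_density_nonneg: "0 \<le> (\<Prod>p\<in>primes_upto y. local_density A p)"
  using primes_upto_ge_2 by (intro prod_nonneg) (auto simp: local_density_nonneg)

text \<open>Every further prime contributes a factor in \<open>[0, 1]\<close>.\<close>

lemma decseq_prod_local_density: "decseq (\<lambda>y. \<Prod>p\<in>primes_upto y. local_density A p)"
proof (rule antimonoI)
  fix y z :: nat assume "y \<le> z"
  then have "primes_upto z = primes_upto y \<union> (primes_upto z - primes_upto y)"
    by (auto simp: primes_upto_def)
  then have "(\<Prod>p\<in>primes_upto z. local_density A p) =
      (\<Prod>p\<in>primes_upto y. local_density A p) * (\<Prod>p\<in>primes_upto z - primes_upto y. local_density A p)"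
    by (metis finite_Diff finite_primes_upto prod.union_disjoint Diff_disjoint)
  also have "\<dots> \<le> (\<Prod>p\<in>primes_upto y. local_density A p)"
  proof (rule mult_left_le)
    show "(\<Prod>p\<in>primes_upto z - primes_upto y. local_density A p) \<le> 1"
      using primes_upto_ge_2 by (intro prod_le_1) (auto simp: local_density_nonneg local_density_le_1)
    show "0 \<le> (\<Prod>p\<in>primes_upto y. local_density A p)"
      by (rule prod_local_density_nonneg)
  qed
  finally show "(\<Prod>p\<in>primes_upto z. local_density A p) \<le> (\<Prod>p\<in>primes_upto y. local_density A p)" .
qed

lemma convergent_prod_local_density:
  obtains L where "(\<lambda>y. \<Prod>p\<in>primes_upto y. local_density A p) \<longlonglongrightarrow> L" "L \<ge> 0"
    "\<And>y. L \<le> (\<Prod>p\<in>primes_upto y. local_density A p)"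
proof -
  obtain L where L: "(\<lambda>y. \<Prod>p\<in>primes_upto y. local_density A p) \<longlonglongrightarrow> L"
    "\<forall>y. L \<le> (\<Prod>p\<in>primes_upto y. local_density A p)"
    using decseq_convergent[OF decseq_prod_local_density, of 0 A] prod_local_density_nonneg by blast
  moreover have "L \<ge> 0"
    using L(1) by (rule LIMSEQ_le_const) (auto intro: prod_local_density_nonneg)
  ultimately show thesis using that by blast
qed

text \<open>Taking logarithms in \<open>L \<le> (\<Prod>p. exp (- w p / 2))\<close>, with
  \<open>w\<close> the weight, bounds every partial sum of the weights by
  \<open>- 2 * ln L\<close>.\<close>

lemma summable_missing_prime_weight:
  assumes "L > 0" "\<And>y. L \<le> (\<Prod>p\<in>primes_upto y. local_density A p)"
  shows "summable (missing_prime_weight A)"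
proof (rule summableI_nonneg_bounded)
  show "0 \<le> missing_prime_weight A n" for n by (rule missing_prime_weight_nonneg)
  show "(\<Sum>n<y. missing_prime_weight A n) \<le> - 2 * ln L" for y
  proof -
    have "L \<le> (\<Prod>p\<in>primes_upto y. local_density A p)" by fact
    also have "\<dots> \<le> (\<Prod>p\<in>primes_upto y. exp (- missing_prime_weight A p / 2))"
    proof (rule prod_mono)
      fix p assume p: "p \<in> primes_upto y"
      have "local_density A p \<le> exp (- missing_prime_weight A p / 2)"
        using local_density_le_exp[of p A] local_density_le_1[of p A]
          primes_upto_ge_2[OF p] primes_upto_prime[OF p]
        by (cases "p \<in> A") (auto simp: missing_prime_weight_def)
      then show "0 \<le> local_density A p \<and> local_density A p \<le> exp (- missing_prime_weight A p / 2)"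
        using local_density_nonneg primes_upto_ge_2[OF p] by blast
    qed
    also have "\<dots> = exp (- (\<Sum>p\<in>primes_upto y. missing_prime_weight A p) / 2)"
      by (simp add: exp_sum[symmetric] sum_negf sum_divide_distrib)
    finally have "ln L \<le> - (\<Sum>p\<in>primes_upto y. missing_prime_weight A p) / 2"
      using assms(1) by (simp add: ln_le_cancel_iff[symmetric, of L "exp _"])
    moreover have "(\<Sum>n<y. missing_prime_weight A n) \<le> (\<Sum>p\<in>primes_upto y. missing_prime_weight A p)"
    proof -
      have "(\<Sum>n<y. missing_prime_weight A n) = (\<Sum>n\<in>{..<y} \<inter> primes_upto y. missing_prime_weight A n)"
        by (rule sum.mono_neutral_right) (auto simp: missing_prime_weight_def primes_upto_def)
      also have "\<dots> \<le> (\<Sum>p\<in>primes_upto y. missing_prime_weight A p)"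
        by (rule sum_mono2) (auto simp: missing_prime_weight_nonneg)
      finally show ?thesis .
    qed
    ultimately show ?thesis by linarith
  qed
qed

section \<open>Comparison of a multiplicative set with its sieved supersets\<close>

lemma sieved_superset:
  assumes "multiplicative_set A"
  shows "A \<subseteq> sieved A (primes_upto y)"
proof
  fix n assume n: "n \<in> A"
  then have "n > 0" using assms by (cases n) (auto simp: multiplicative_set_def)
  then show "n \<in> sieved A (primes_upto y)"
    using multiplicative_set_iff[OF assms, of n] n by (auto simp: sieved_def primes_upto_def)
qed

text \<open>Such an \<open>n\<close> fails the condition at some prime \<open>p > y\<close>. The
  exponent of \<open>p\<close> there is not \<open>0\<close>, since \<open>1 \<in> A\<close>;
  exponent \<open>1\<close> means \<open>p \<notin> A\<close>, and a larger one gives a square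
  divisor.\<close>

lemma sieved_diff_cover:
  assumes "multiplicative_set A" "n \<in> sieved A (primes_upto y)" "n \<notin> A"
  obtains p where "p > y" "p \<le> n" "prime p" "p dvd n" "p \<notin> A \<or> p\<^sup>2 dvd n"
proof -
  have "n > 0" using assms(2) by (simp add: sieved_def)
  then obtain p where p: "prime p" "p ^ multiplicity p n \<notin> A"
    using multiplicative_set_iff assms by blast
  then have "p > y" using assms(2) by (auto simp: sieved_def primes_upto_def not_less[symmetric])
  moreover have m0: "multiplicity p n \<noteq> 0"
  proof
    assume "multiplicity p n = 0"
    then show False using p(2) assms(1) by (simp add: multiplicative_set_def)
  qed
  then have "p dvd n" using not_dvd_imp_multiplicity_0[of p n] by (cases "p dvd n") auto
  moreover have "p \<le> n" using \<open>p dvd n\<close> \<open>n > 0\<close> by (rule dvd_imp_le)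
  moreover have "p \<notin> A \<or> p\<^sup>2 dvd n"
  proof (cases "multiplicity p n = 1")
    case True
    then show ?thesis using p(2) by simp
  next
    case False
    then have "2 \<le> multiplicity p n" using m0 by linarith
    then show ?thesis by (simp add: multiplicity_dvd')
  qed
  ultimately show thesis using that p(1) by blast
qed

lemma count_upto_sieved_diff:
  assumes A: "multiplicative_set A" and "x > 0"
  shows "count_upto (sieved A (primes_upto y) - A) x \<le>
    (\<Sum>m\<in>{y<..nat \<lfloor>x\<rfloor>}. missing_prime_weight A m + 1 / real m ^ 2) * x"
proof -
  \<comment> \<open>The two ways to fail at a prime \<open>m\<close>. The squares are taken for all
    \<open>m\<close>, prime or not, which costs only a tail of the convergent series of
    \<open>1 / m^2\<close>. As \<open>p \<le> n \<le> x\<close>, finitely many \<open>m\<close>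
    suffice.\<close>
  define M where "M m = (if prime m \<and> m \<notin> A then {n. m dvd n} else {}) \<union> {n::nat. m\<^sup>2 dvd n}" for m
  have "{n \<in> sieved A (primes_upto y) - A. 1 \<le> n \<and> real n \<le> x} \<subseteq>
      {n \<in> (\<Union>m\<in>{y<..nat \<lfloor>x\<rfloor>}. M m). 1 \<le> n \<and> real n \<le> x}"
  proof safe
    fix n assume n: "n \<in> sieved A (primes_upto y)" "n \<notin> A" "1 \<le> n" "real n \<le> x"
    obtain p where p: "p > y" "p \<le> n" "prime p" "p dvd n" "p \<notin> A \<or> p\<^sup>2 dvd n"
      using sieved_diff_cover[OF A n(1,2)] by blast
    have "p \<le> nat \<lfloor>x\<rfloor>" using p(2) n(4) le_nat_floor by (meson le_trans)
    moreover have "n \<in> M p" using p by (auto simp: M_def)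
    ultimately show "n \<in> (\<Union>m\<in>{y<..nat \<lfloor>x\<rfloor>}. M m)" using p(1) by auto
  qed
  then have "count_upto (sieved A (primes_upto y) - A) x \<le> count_upto (\<Union>m\<in>{y<..nat \<lfloor>x\<rfloor>}. M m) x"
    unfolding count_upto_def of_nat_le_iff by (rule card_mono[OF finite_upto])
  also have "\<dots> \<le> (\<Sum>m\<in>{y<..nat \<lfloor>x\<rfloor>}. count_upto (M m) x)"
    by (rule count_upto_UN_le) simp
  also have "\<dots> \<le> (\<Sum>m\<in>{y<..nat \<lfloor>x\<rfloor>}. (missing_prime_weight A m + 1 / real m ^ 2) * x)"
  proof (rule sum_mono)
    fix m assume "m \<in> {y<..nat \<lfloor>x\<rfloor>}"
    then have m: "m > 0" by simp
    have "count_upto (M m) x \<le>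
        count_upto (if prime m \<and> m \<notin> A then {n. m dvd n} else {}) x + count_upto {n. m\<^sup>2 dvd n} x"
      unfolding M_def by (rule count_upto_Un_le)
    also have "count_upto (if prime m \<and> m \<notin> A then {n. m dvd n} else {}) x \<le> missing_prime_weight A m * x"
      using count_upto_multiples_le[of m x] m \<open>x > 0\<close>
      by (auto simp: missing_prime_weight_def) (simp_all add: count_upto_def)
    also have "count_upto {n. m\<^sup>2 dvd n} x \<le> 1 / real m ^ 2 * x"
      using count_upto_multiples_le[of "m\<^sup>2" x] m \<open>x > 0\<close> by simp
    finally show "count_upto (M m) x \<le> (missing_prime_weight A m + 1 / real m ^ 2) * x"
      by (simp add: distrib_right)
  qed
  finally show ?thesis by (simp add: sum_distrib_right)
qed

text \<open>If the limit is positive, then the missing primes have a convergent reciprocal sum, so the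
  sieved sets exceed \<open>A\<close> by a set of small upper density; if the limit is zero, already the sieved
  supersets force density zero.\<close>

lemma has_density_multiplicative_set:
  assumes A: "multiplicative_set A"
    and L: "(\<lambda>y. \<Prod>p\<in>primes_upto y. local_density A p) \<longlonglongrightarrow> L"
  shows "has_density A L"
proof -
  obtain L' where L': "(\<lambda>y. \<Prod>p\<in>primes_upto y. local_density A p) \<longlonglongrightarrow> L'" "L' \<ge> 0"
    "\<And>y. L' \<le> (\<Prod>p\<in>primes_upto y. local_density A p)"
    using convergent_prod_local_density[of A] by blast
  then have [simp]: "L' = L" using L LIMSEQ_unique by blast
  have dens: "has_density (sieved A (primes_upto y)) (\<Prod>p\<in>primes_upto y. local_density A p)" for y
    by (intro has_density_sieved primes_upto_prime) auto
  show ?thesis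
  proof (cases "L = 0")
    case True
    show ?thesis
      unfolding has_density_count True
    proof (rule tendstoI)
      fix e :: real assume e: "e > 0"
      have "eventually (\<lambda>y. (\<Prod>p\<in>primes_upto y. local_density A p) < e) sequentially"
        using L e True by (auto intro: order_tendstoD)
      then obtain y where y: "(\<Prod>p\<in>primes_upto y. local_density A p) < e"
        by (auto simp: eventually_sequentially)
      have "eventually (\<lambda>x. count_upto (sieved A (primes_upto y)) x / x < e) at_top"
        using dens[of y] y unfolding has_density_count by (rule order_tendstoD)
      then show "eventually (\<lambda>x. dist (count_upto A x / x) 0 < e) at_top"
        using eventually_gt_at_top[of 0]
      proof eventually_elim
        case (elim x)
        have "count_upto A x / x \<le> count_upto (sieved A (primes_upto y)) x / x"
          using elim count_upto_mono[OF sieved_superset[OF A]] by (intro divide_right_mono) auto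
        then show ?case using elim count_upto_nonneg[of A x] by (simp add: dist_real_def)
      qed
    qed
  next
    case False
    then have "L > 0" using L'(2) by simp
    define c where "c m = missing_prime_weight A m + 1 / real m ^ 2" for m
    have c0: "c m \<ge> 0" for m by (simp add: c_def missing_prime_weight_nonneg)
    have "summable (missing_prime_weight A)"
      using summable_missing_prime_weight[of L A] \<open>L > 0\<close> L'(3) by simp
    moreover have "summable (\<lambda>m. 1 / real m ^ 2)"
      using inverse_power_summable[of 2, where 'a = real] by (simp add: inverse_eq_divide)
    ultimately have c: "summable c" unfolding c_def by (rule summable_add)
    \<comment> \<open>The bound \<open>Suc y\<close> removes the indices up to and including
      \<open>y\<close>, leaving the tail over \<open>m > y\<close>. At \<open>m = 0\<close> the
      convention \<open>1 / 0 = 0\<close> gives \<open>c 0 = 0\<close>.\<close>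
    have "(\<lambda>y. suminf c - (\<Sum>m<Suc y. c m)) \<longlonglongrightarrow> suminf c - suminf c"
      by (intro tendsto_diff tendsto_const LIMSEQ_Suc summable_LIMSEQ c)
    then have "(\<lambda>y. suminf c - (\<Sum>m<Suc y. c m)) \<longlonglongrightarrow> 0" by simp
    moreover have "\<bar>count_upto (sieved A (primes_upto y)) x - count_upto A x\<bar> \<le>
        (suminf c - (\<Sum>m<Suc y. c m)) * x" if "x > 0" for x y
    proof -
      have "(\<Sum>m<Suc y. c m) + (\<Sum>m\<in>{y<..nat \<lfloor>x\<rfloor>}. c m) = (\<Sum>m\<in>{..<Suc y} \<union> {y<..nat \<lfloor>x\<rfloor>}. c m)"
        by (rule sum.union_disjoint[symmetric]) auto
      also have "\<dots> \<le> suminf c" using c c0 by (intro sum_le_suminf) auto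
      finally have "(\<Sum>m\<in>{y<..nat \<lfloor>x\<rfloor>}. c m) \<le> suminf c - (\<Sum>m<Suc y. c m)" by linarith
      then have "(\<Sum>m\<in>{y<..nat \<lfloor>x\<rfloor>}. c m) * x \<le> (suminf c - (\<Sum>m<Suc y. c m)) * x"
        using that by (intro mult_right_mono) auto
      moreover have "count_upto (sieved A (primes_upto y) - A) x \<le> (\<Sum>m\<in>{y<..nat \<lfloor>x\<rfloor>}. c m) * x"
        unfolding c_def by (rule count_upto_sieved_diff[OF A that])
      ultimately show ?thesis
        using count_upto_mono[OF sieved_superset[OF A], of x y]
        unfolding count_upto_diff[OF sieved_superset[OF A]] by linarith
    qed
    ultimately show ?thesis by (intro has_density_approx[OF dens _ _ L])
  qed
qed

section \<open>Partial Euler products\<close>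

text \<open>Expanding the product yields each integer at most once, by unique factorization. The
  clause on prime divisors carries the induction: it says that the new prime divides no member of
  \<open>E\<close>.\<close>

lemma partial_euler_product:
  fixes a :: "nat \<Rightarrow> real"
  assumes "finite P" "\<And>p. p \<in> P \<Longrightarrow> prime p" and a1: "a 1 = 1"
    and mult: "\<And>m n. m > 0 \<Longrightarrow> n > 0 \<Longrightarrow> coprime m n \<Longrightarrow> a (m * n) = a m * a n"
  shows "\<exists>E. finite E \<and> 0 \<notin> E \<and> (\<forall>n\<in>E. \<forall>q. prime q \<longrightarrow> q dvd n \<longrightarrow> q \<in> P) \<and>
    (\<Prod>p\<in>P. \<Sum>k<K. a (p ^ k)) = sum a E"
  using assms(1,2)
proof (induction P rule: finite_induct)
  case empty
  show ?case using a1 by (intro exI[of _ "{1}"]) auto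
next
  case (insert p P)
  then obtain E where E: "finite E" "0 \<notin> E" "\<And>n q. n \<in> E \<Longrightarrow> prime q \<Longrightarrow> q dvd n \<Longrightarrow> q \<in> P"
    "(\<Prod>p\<in>P. \<Sum>k<K. a (p ^ k)) = sum a E" by auto
  have p: "prime p" using insert.prems by simp
  have p0: "p > 0" using p by (rule prime_gt_0_nat)
  have ndvd: "\<not> p dvd m" if "m \<in> E" for m using E(3)[OF that p] insert.hyps(2) by blast
  define h where "h = (\<lambda>(k, m). p ^ k * m)"
  have mul: "multiplicity p (p ^ k * m) = k" if "m \<in> E" for k m
  proof (rule multiplicity_eqI)
    show "\<not> p ^ Suc k dvd p ^ k * m" using ndvd[OF that] p0 by (auto simp: mult.commute)
  qed simp
  \<comment> \<open>The multiplicity of \<open>p\<close> recovers \<open>k\<close>, and cancelling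
    \<open>p ^ k\<close> recovers \<open>m\<close>.\<close>
  have inj: "inj_on h ({..<K} \<times> E)"
  proof (rule inj_onI, clarify)
    fix k m k' m' assume km: "m \<in> E" "m' \<in> E" and eq: "h (k, m) = h (k', m')"
    then have "k = k'" using mul[of m k] mul[of m' k'] by (simp add: h_def)
    then show "k = k' \<and> m = m'" using eq p0 by (simp add: h_def)
  qed
  have "sum a (h ` ({..<K} \<times> E)) = (\<Sum>(k, m)\<in>{..<K} \<times> E. a (p ^ k) * a m)"
    unfolding sum.reindex[OF inj]
  proof (rule sum.cong, simp, clarify)
    fix k m assume "m \<in> E"
    then have "coprime (p ^ k) m" "m > 0"
      using ndvd p E(2) by (auto simp: prime_imp_coprime intro: gr0I)
    then show "(a \<circ> h) (k, m) = a (p ^ k) * a m" using mult[of "p ^ k" m] p0 by (simp add: h_def)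
  qed
  also have "\<dots> = (\<Sum>k<K. a (p ^ k)) * sum a E"
    by (simp add: sum_product sum.cartesian_product)
  finally have "(\<Prod>p\<in>insert p P. \<Sum>k<K. a (p ^ k)) = sum a (h ` ({..<K} \<times> E))"
    using insert.hyps E(4) by simp
  moreover have "q \<in> insert p P" if n: "n \<in> h ` ({..<K} \<times> E)" and q: "prime q" "q dvd n" for n q
  proof -
    obtain k m where "m \<in> E" "n = p ^ k * m" using n by (auto simp: h_def)
    then show ?thesis
      using q E(3)[of m q] p by (auto simp: prime_dvd_mult_iff dest: prime_dvd_power primes_dvd_imp_eq)
  qed
  moreover have "0 \<notin> h ` ({..<K} \<times> E)" using E(2) p0 by (auto simp: h_def)
  ultimately show ?case using E(1) by (intro exI[of _ "h ` ({..<K} \<times> E)"]) auto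
qed

text \<open>Truncating each factor at \<open>K\<close> terms turns the product into a finite sum of
  values of \<open>a\<close>, bounded by \<open>T\<close>; then \<open>K\<close> tends to
  infinity.\<close>

lemma euler_product_le:
  fixes a s :: "nat \<Rightarrow> real"
  assumes "finite P" "\<And>p. p \<in> P \<Longrightarrow> prime p" "a 1 = 1"
    and "\<And>m n. m > 0 \<Longrightarrow> n > 0 \<Longrightarrow> coprime m n \<Longrightarrow> a (m * n) = a m * a n"
    and bound: "\<And>E. finite E \<Longrightarrow> 0 \<notin> E \<Longrightarrow> sum a E \<le> T"
    and s: "\<And>p. p \<in> P \<Longrightarrow> (\<lambda>k. a (p ^ k)) sums s p"
  shows "prod s P \<le> T"
proof (rule LIMSEQ_le_const2)
  show "(\<lambda>K. \<Prod>p\<in>P. \<Sum>k<K. a (p ^ k)) \<longlonglongrightarrow> prod s P"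
    using s unfolding sums_def by (rule tendsto_prod)
  have "(\<Prod>p\<in>P. \<Sum>k<K. a (p ^ k)) \<le> T" for K
  proof -
    obtain E where "finite E" "0 \<notin> E" "(\<Prod>p\<in>P. \<Sum>k<K. a (p ^ k)) = sum a E"
      using partial_euler_product[OF assms(1-4), of K] by blast
    then show ?thesis using bound by simp
  qed
  then show "\<exists>N. \<forall>K\<ge>N. (\<Prod>p\<in>P. \<Sum>k<K. a (p ^ k)) \<le> T" by blast
qed

lemma prod_local_series_le:
  assumes A: "multiplicative_set A"
    and bound: "\<And>E. finite E \<Longrightarrow> E \<subseteq> A \<Longrightarrow> (\<Sum>n\<in>E. 1 / real n) \<le> T"
  shows "(\<Prod>p\<in>primes_upto y. local_series A p) \<le> T"
proof (rule euler_product_le[where a = "\<lambda>n. if n \<in> A then 1 / real n else 0"])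
  show "(\<Sum>n\<in>E. if n \<in> A then 1 / real n else 0) \<le> T" if "finite E" for E
    using bound[of "E \<inter> A"] that by (simp add: sum.inter_restrict)
  show "(\<lambda>k. if p ^ k \<in> A then 1 / real (p ^ k) else 0) sums local_series A p"
    if "p \<in> primes_upto y" for p
    using summable_sums[OF summable_local_series[OF primes_upto_ge_2[OF that]], of A]
    by (simp add: local_series_def cong: if_cong)
qed (use A in \<open>auto simp: multiplicative_set_def primes_upto_def\<close>)

text \<open>The reciprocals of the factors are the Euler factors of
  \<open>\<zeta>(2) = pi^2 / 6\<close>, so their partial products do not exceed that value.\<close>

lemma prod_one_minus_inverse_square_ge:
  "(\<Prod>p\<in>primes_upto y. 1 - 1 / (real p)\<^sup>2) \<ge> 6 / pi\<^sup>2"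
proof -
  have pos: "1 - 1 / (real p)\<^sup>2 > 0" if "p \<in> primes_upto y" for p
    using primes_upto_ge_2[OF that] by (simp add: one_less_power)
  have squares: "(\<lambda>n. 1 / (real n + 1)\<^sup>2) sums (pi\<^sup>2 / 6)"
    using inverse_squares_sums by (simp add: add.commute)
  have "(\<Prod>p\<in>primes_upto y. 1 / (1 - 1 / (real p)\<^sup>2)) \<le> pi\<^sup>2 / 6"
  proof (rule euler_product_le[where a = "\<lambda>n. 1 / (real n)\<^sup>2"])
    show "(\<Sum>n\<in>E. 1 / (real n)\<^sup>2) \<le> pi\<^sup>2 / 6" if "finite E" "0 \<notin> E" for E
    proof -
      have nz: "n \<noteq> 0" if "n \<in> E" for n using that \<open>0 \<notin> E\<close> by metis
      \<comment> \<open>The Basel series is indexed from \<open>0\<close> with terms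
        \<open>1 / (n + 1)^2\<close>, hence the shift by one, which is injective as
        \<open>0 \<notin> E\<close>.\<close>
      have "(\<Sum>n\<in>E. 1 / (real n)\<^sup>2) = (\<Sum>n\<in>(\<lambda>n. n - 1) ` E. 1 / (real n + 1)\<^sup>2)"
        by (rule sum.reindex_bij_witness[of _ Suc "\<lambda>n. n - 1"]) (use nz in \<open>auto simp: of_nat_diff Suc_leI\<close>)
      also have "\<dots> \<le> (\<Sum>n. 1 / (real n + 1)\<^sup>2)"
        by (intro sum_le_suminf sums_summable[OF squares]) (use that(1) in auto)
      also have "\<dots> = pi\<^sup>2 / 6" by (rule sums_unique[OF squares, symmetric])
      finally show ?thesis .
    qed
    show "(\<lambda>k. 1 / (real (p ^ k))\<^sup>2) sums (1 / (1 - 1 / (real p)\<^sup>2))" if "p \<in> primes_upto y" for p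
    proof -
      have "1 / (real (p ^ k))\<^sup>2 = (1 / (real p)\<^sup>2) ^ k" for k
        by (simp add: power_one_over power_commutes power_mult[of "real p", symmetric] mult.commute[of k 2])
      moreover have "norm (1 / (real p)\<^sup>2) < 1" using pos[OF that] by simp
      ultimately show ?thesis using geometric_sums[of "1 / (real p)\<^sup>2"] by presburger
    qed
  qed (auto simp: primes_upto_def power_mult_distrib)
  then have "1 / (\<Prod>p\<in>primes_upto y. 1 - 1 / (real p)\<^sup>2) \<le> pi\<^sup>2 / 6"
    by (simp add: prod_dividef)
  moreover have "(\<Prod>p\<in>primes_upto y. 1 - 1 / (real p)\<^sup>2) > 0" using pos by (rule prod_pos)
  ultimately show ?thesis by (simp add: field_simps)
qed

section \<open>The lower bound\<close>

lemma nonsupp_factor_pos: "nonsupp_factor \<nu> p > 0"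
  by (auto simp: nonsupp_factor_def intro: add_pos_nonneg)

lemma nonsupp_factor_le_1: "nonsupp_factor \<nu> p \<le> 1"
  by (simp add: nonsupp_factor_def inverse_le_1_iff)

text \<open>A factor at a missing prime differs from \<open>1\<close> by
  \<open>1 / (p + 1) \<le> 1 / p\<close>, so the product converges absolutely.\<close>

lemma convergent_prod_nonsupp_factor:
  assumes "summable (missing_prime_weight (arith_supp \<nu>))"
  shows "convergent_prod (nonsupp_factor \<nu>)"
proof (rule abs_convergent_prod_imp_convergent_prod, rule summable_imp_abs_convergent_prod)
  show "summable (\<lambda>p. norm (nonsupp_factor \<nu> p - 1))"
  proof (rule summable_comparison_test'[OF assms, of 0])
    fix p
    have "\<bar>inverse (1 + 1 / real p) - 1\<bar> \<le> 1 / real p" if "prime p"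
    proof -
      have "real p > 0" using that prime_gt_0_nat by simp
      then have "inverse (1 + 1 / real p) - 1 = - (1 / (real p + 1))" by (simp add: field_simps)
      then show ?thesis using \<open>real p > 0\<close> by (simp add: field_simps)
    qed
    then show "norm (norm (nonsupp_factor \<nu> p - 1)) \<le> missing_prime_weight (arith_supp \<nu>) p"
      by (simp add: nonsupp_factor_def missing_prime_weight_def)
  qed
qed

text \<open>Positive factors alone only give a nonnegative limit. That it is nonzero is part of the
  notion \<open>convergent_prod\<close>, under which an infinite product vanishes only if some
  factor does.\<close>

lemma prodinf_nonsupp_factor_pos:
  assumes "convergent_prod (nonsupp_factor \<nu>)"
  shows "(\<Prod>p. nonsupp_factor \<nu> p) > 0"
proof -
  have "(\<Prod>p. nonsupp_factor \<nu> p) \<ge> 0"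
    by (rule LIMSEQ_le_const[OF convergent_prod_LIMSEQ[OF assms]])
      (auto intro!: prod_nonneg less_imp_le[OF nonsupp_factor_pos])
  moreover have "(\<Prod>p. nonsupp_factor \<nu> p) \<noteq> 0"
    using prodinf_nonzero[OF assms] nonsupp_factor_pos by (metis less_irrefl)
  ultimately show ?thesis by linarith
qed

text \<open>All factors lie in \<open>(0, 1]\<close>, so dropping some of them can only enlarge the
  product.\<close>

lemma prodinf_nonsupp_factor_le:
  assumes "convergent_prod (nonsupp_factor \<nu>)"
  shows "(\<Prod>p. nonsupp_factor \<nu> p) \<le> (\<Prod>p\<in>primes_upto y. nonsupp_factor \<nu> p)"
proof -
  have "(\<Prod>p\<le>n. nonsupp_factor \<nu> p) \<le> (\<Prod>p\<in>primes_upto y. nonsupp_factor \<nu> p)" if "n \<ge> y" for n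
  proof -
    have "(\<Prod>p\<le>n. nonsupp_factor \<nu> p) =
        (\<Prod>p\<in>{..n} - primes_upto y. nonsupp_factor \<nu> p) * (\<Prod>p\<in>primes_upto y. nonsupp_factor \<nu> p)"
      using that by (intro prod.subset_diff) (auto simp: primes_upto_def)
    also have "\<dots> \<le> 1 * (\<Prod>p\<in>primes_upto y. nonsupp_factor \<nu> p)"
      by (intro mult_right_mono prod_le_1 prod_nonneg)
        (auto simp: nonsupp_factor_le_1 less_imp_le[OF nonsupp_factor_pos])
    finally show ?thesis by simp
  qed
  then show ?thesis by (intro LIMSEQ_le_const2[OF convergent_prod_LIMSEQ[OF assms]]) blast
qed

lemma dirichlet_conv_prime:
  assumes "prime p" "multiplicative_fun f" "multiplicative_fun \<nu>"
  shows "dirichlet_conv f \<nu> p = f p + \<nu> p"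
proof -
  have "{d. d dvd p} = {1, p}" using assms(1) by (auto simp: prime_nat_iff)
  moreover have "p > 1" using assms(1) by (rule prime_gt_1_nat)
  ultimately show ?thesis using assms(2,3) by (simp add: dirichlet_conv_def multiplicative_fun_def)
qed

text \<open>The inequality of the theorem at one prime. Since
  \<open>1 - 1/p^2 = (1 - 1/p) * (1 + 1/p)\<close> and the first factor belongs to the local density
  of \<open>g\<close>, a bound on \<open>G * F\<close> remains. If \<open>\<nu> p = 0\<close>, the
  factor of \<nu> cancels \<open>1 + 1/p\<close> and \<open>G * F \<ge> 1\<close> is enough.\<close>

lemma local_density_conv_ge:
  assumes p: "prime p" and f: "multiplicative_fun f" and g: "multiplicative_fun g"
    and \<nu>: "multiplicative_fun \<nu>" and conv: "\<forall>n>0. g n = dirichlet_conv f \<nu> n"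
  shows "(1 - 1 / (real p)\<^sup>2) * nonsupp_factor \<nu> p \<le>
    local_density (arith_supp g) p * local_series (arith_supp f) p"
proof -
  define F G where "F = local_series (arith_supp f) p" and "G = local_series (arith_supp g) p"
  have p2: "p \<ge> 2" using p by (rule prime_ge_2_nat)
  have one: "1 \<in> arith_supp f" "1 \<in> arith_supp g"
    using f g by (auto simp: arith_supp_def multiplicative_fun_def)
  have F1: "F \<ge> 1" and G1: "G \<ge> 1"
    unfolding F_def G_def using p2 one by (auto intro: local_series_ge_1)
  have key: "(1 + 1 / real p) * nonsupp_factor \<nu> p \<le> G * F"
  proof (cases "p \<in> arith_supp \<nu>")
    case True
    have "g p = f p + \<nu> p" using conv dirichlet_conv_prime[OF p f \<nu>] p2 by simp
    then have "p \<in> arith_supp f \<or> p \<in> arith_supp g" using True by (auto simp: arith_supp_def)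
    then have "F \<ge> 1 + 1 / real p \<or> G \<ge> 1 + 1 / real p"
      unfolding F_def G_def using p2 one local_series_ge_2 by blast
    then have "1 + 1 / real p \<le> G * F"
      using F1 G1 mult_mono[of "1 + 1 / real p" G 1 F] mult_mono[of 1 G "1 + 1 / real p" F] by auto
    then show ?thesis using True by (simp add: nonsupp_factor_def)
  next
    case False
    have "1 + 1 / real p > 0" by (simp add: add_pos_nonneg)
    then have "(1 + 1 / real p) * nonsupp_factor \<nu> p = 1"
      using False p by (simp add: nonsupp_factor_def)
    also have "1 \<le> G * F" using F1 G1 mult_mono[of 1 G 1 F] by simp
    finally show ?thesis .
  qed
  have "(1 - 1 / (real p)\<^sup>2) * nonsupp_factor \<nu> p =
      (1 - 1 / real p) * ((1 + 1 / real p) * nonsupp_factor \<nu> p)"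
    using p2 by (simp add: field_simps power2_eq_square)
  also have "\<dots> \<le> (1 - 1 / real p) * (G * F)"
    using key by (rule mult_left_mono) (use p2 in simp)
  finally show ?thesis by (simp add: local_density_def F_def G_def mult.assoc)
qed

theorem theorem1p4:
  fixes \<nu> :: "nat \<Rightarrow> complex"
  assumes "multiplicative_fun \<nu>"
    and "\<exists>\<delta>>0. has_density (arith_supp \<nu>) \<delta>"
  shows "convergent_prod (nonsupp_factor \<nu>) \<and> (\<Prod>p. nonsupp_factor \<nu> p) > 0 \<and> C_const \<nu> > 0 \<and>
    (\<forall>f g :: nat \<Rightarrow> complex.
       multiplicative_fun f \<and> multiplicative_fun g \<and> (\<forall>n>0. g n = dirichlet_conv f \<nu> n) \<longrightarrow>
       (\<exists>\<delta>. has_density (arith_supp g) \<delta> \<and>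
            ereal \<delta> \<ge> ereal (C_const \<nu>) / (\<Sum>\<^sub>\<infinity>n\<in>arith_supp f. ereal (1 / real n))))"
proof -
  obtain \<delta> where \<delta>: "\<delta> > 0" "has_density (arith_supp \<nu>) \<delta>" using assms(2) by blast
  obtain L where L: "(\<lambda>y. \<Prod>p\<in>primes_upto y. local_density (arith_supp \<nu>) p) \<longlonglongrightarrow> L" "L \<ge> 0"
    "\<And>y. L \<le> (\<Prod>p\<in>primes_upto y. local_density (arith_supp \<nu>) p)"
    using convergent_prod_local_density[of "arith_supp \<nu>"] by blast
  have "has_density (arith_supp \<nu>) L"
    using multiplicative_set_arith_supp[OF assms(1)] L(1) by (rule has_density_multiplicative_set)
  \<comment> \<open>Uniqueness of densities carries the assumed positivity over to the limit of the
    products.\<close>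
  then have "L = \<delta>"
    using \<delta>(2) tendsto_unique[OF trivial_limit_at_top_linorder] unfolding has_density_count by blast
  then have "summable (missing_prime_weight (arith_supp \<nu>))"
    using summable_missing_prime_weight[of L] L(3) \<delta>(1) by simp
  then have conv: "convergent_prod (nonsupp_factor \<nu>)" by (rule convergent_prod_nonsupp_factor)
  note pos = prodinf_nonsupp_factor_pos[OF conv]
  have C: "C_const \<nu> > 0" using pos by (simp add: C_const_def)
  have "\<exists>\<delta>. has_density (arith_supp g) \<delta> \<and>
      ereal \<delta> \<ge> ereal (C_const \<nu>) / (\<Sum>\<^sub>\<infinity>n\<in>arith_supp f. ereal (1 / real n))"
    if f: "multiplicative_fun f" and g: "multiplicative_fun g"
      and fg: "\<forall>n>0. g n = dirichlet_conv f \<nu> n" for f g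
  proof -
    obtain M where M: "(\<lambda>y. \<Prod>p\<in>primes_upto y. local_density (arith_supp g) p) \<longlonglongrightarrow> M" "M \<ge> 0"
      "\<And>y. M \<le> (\<Prod>p\<in>primes_upto y. local_density (arith_supp g) p)"
      using convergent_prod_local_density[of "arith_supp g"] by blast
    have dens: "has_density (arith_supp g) M"
      using multiplicative_set_arith_supp[OF g] M(1) by (rule has_density_multiplicative_set)
    define S where "S = (\<Sum>\<^sub>\<infinity>n\<in>arith_supp f. ereal (1 / real n))"
    \<comment> \<open>Nonnegative terms make the infinite sum the supremum of its finite subsums,
      the form in which the bound on Euler products uses it.\<close>
    have partial: "ereal (\<Sum>n\<in>E. 1 / real n) \<le> S" if "finite E" "E \<subseteq> arith_supp f" for E
    proof -
      have "S = (SUP F\<in>{F. finite F \<and> F \<subseteq> arith_supp f}. \<Sum>n\<in>F. ereal (1 / real n))"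
        unfolding S_def by (rule nonneg_infsum_complete) simp
      also have "\<dots> \<ge> (\<Sum>n\<in>E. ereal (1 / real n))" using that by (intro SUP_upper) auto
      finally show ?thesis by simp
    qed
    \<comment> \<open>The term at \<open>n = 1\<close> gives \<open>S \<ge> 1\<close>, so the
      quotient never divides by \<open>0\<close>.\<close>
    have "1 \<in> arith_supp f" using f by (simp add: arith_supp_def multiplicative_fun_def)
    then have S1: "S \<ge> 1" using partial[of "{1}"] by (simp add: one_ereal_def)
    have "ereal (C_const \<nu>) / S \<le> ereal M"
    proof (cases S)
      case (real T)
      have T1: "T \<ge> 1" using S1 real by (simp add: one_ereal_def)
      have "C_const \<nu> \<le> (\<Prod>p\<in>primes_upto y. local_density (arith_supp g) p) * T" for y
      proof -
        \<comment> \<open>Both partial products lie above their limits: \<open>6 / pi^2\<close> for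
          the first, the infinite product over missing primes for the second.\<close>
        have "C_const \<nu> \<le> (\<Prod>p\<in>primes_upto y. 1 - 1 / (real p)\<^sup>2) * (\<Prod>p\<in>primes_upto y. nonsupp_factor \<nu> p)"
          unfolding C_const_def
          using prod_one_minus_inverse_square_ge prodinf_nonsupp_factor_le[OF conv] pos
          by (intro mult_mono order_trans[OF _ prod_one_minus_inverse_square_ge]) auto
        also have "\<dots> = (\<Prod>p\<in>primes_upto y. (1 - 1 / (real p)\<^sup>2) * nonsupp_factor \<nu> p)"
          by (simp add: prod.distrib)
        also have "\<dots> \<le> (\<Prod>p\<in>primes_upto y. local_density (arith_supp g) p * local_series (arith_supp f) p)"
        proof (rule prod_mono)
          fix p assume p: "p \<in> primes_upto y"
          have "1 - 1 / (real p)\<^sup>2 \<ge> 0" using primes_upto_ge_2[OF p] by simp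
          then show "0 \<le> (1 - 1 / (real p)\<^sup>2) * nonsupp_factor \<nu> p \<and>
              (1 - 1 / (real p)\<^sup>2) * nonsupp_factor \<nu> p \<le>
              local_density (arith_supp g) p * local_series (arith_supp f) p"
            using local_density_conv_ge[OF primes_upto_prime[OF p] f g assms(1) fg]
              nonsupp_factor_pos[of \<nu> p] by simp
        qed
        also have "\<dots> = (\<Prod>p\<in>primes_upto y. local_density (arith_supp g) p) *
            (\<Prod>p\<in>primes_upto y. local_series (arith_supp f) p)"
          by (simp add: prod.distrib)
        also have "\<dots> \<le> (\<Prod>p\<in>primes_upto y. local_density (arith_supp g) p) * T"
          using partial real
          by (intro mult_left_mono prod_local_series_le[OF multiplicative_set_arith_supp[OF f]]
              prod_local_density_nonneg) auto
        finally show ?thesis .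
      qed
      moreover have "(\<lambda>y. (\<Prod>p\<in>primes_upto y. local_density (arith_supp g) p) * T) \<longlonglongrightarrow> M * T"
        by (intro tendsto_mult M(1) tendsto_const)
      ultimately have "C_const \<nu> \<le> M * T" by (intro LIMSEQ_le_const) auto
      then show ?thesis using T1 real by (simp add: field_simps)
    \<comment> \<open>For \<open>S = \<infinity>\<close> the quotient is \<open>0\<close> and
      \<open>M \<ge> 0\<close> settles it; \<open>S = -\<infinity>\<close> contradicts
      \<open>S \<ge> 1\<close>.\<close>
    qed (use S1 M(2) in auto)
    then show ?thesis using dens unfolding S_def by blast
  qed
  then show ?thesis using conv pos C by blast
qed

end
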